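(* Let $\lambda$ be a nonzero real number. Let $\{T_{n}^{(3)}\}_{n\ge 0}$ be defined by $T_{0}^{(3)}=T_{1}^{(3)}=0$, $T_{2}^{(3)}=1$ and $T_{n+3}^{(3)}=T_{n+2}^{(3)}+3T_{n+1}^{(3)}+9T_{n}^{(3)}$ for $n\ge 0$. Then for all $n\ge 2$, $$T_{n-1}^{(3)}=\frac{1}{9\lambda^{n}}H_{n}^{(3)}(1,0,0;\lambda,3\lambda^{2},9\lambda^{3}),$$ where $H_n^{(3)}(a,b,c;r,s,t)$ denotes the $n$-th third-order Horadam number.
   Context: For given numbers $a,b,c,r,s,t$, the third-order Horadam numbers $H_{n}^{(3)}=H_{n}^{(3)}(a,b,c;r,s,t)$, $n\ge 0$, are defined by $H_{0}^{(3)}=a$, $H_{1}^{(3)}=b$, $H_{2}^{(3)}=c$ and $H_{n+3}^{(3)}=rH_{n+2}^{(3)}+sH_{n+1}^{(3)}+tH_{n}^{(3)}$ for $n\ge 0$. The superscript $(3)$ is part of the notation, not an exponent. *)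

theory Defs
  imports Complex_Main
begin

fun horadam3 :: "'a::comm_ring_1 \<Rightarrow> 'a \<Rightarrow> 'a \<Rightarrow> 'a \<Rightarrow> 'a \<Rightarrow> 'a \<Rightarrow> nat \<Rightarrow> 'a" where
  "horadam3 a b c r s t 0 = a"
| "horadam3 a b c r s t (Suc 0) = b"
| "horadam3 a b c r s t (Suc (Suc 0)) = c"
| "horadam3 a b c r s t (Suc (Suc (Suc n))) =
     r * horadam3 a b c r s t (Suc (Suc n))
     + s * horadam3 a b c r s t (Suc n)
     + t * horadam3 a b c r s t n"

end

theory Submission
  imports Defs
begin

text \<open>Multiplying a sequence by powers of \<open>l\<close> multiplies the recurrence
  coefficients 1, 3, 9 by \<open>l\<close>, \<open>l ^ 2\<close>, \<open>l ^ 3\<close>. So the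
  Horadam sequence shifted by one and \<open>9 * l ^ Suc n * T n\<close> obey the same recurrence;
  both start 0, 0, \<open>9 * l ^ 3\<close>, hence they agree. Dividing by \<open>9 * l ^ n\<close>
  gives the claim.\<close>

text \<open>The division-free, shifted form makes sense in any commutative ring and avoids
  \<open>n - 1\<close> in the induction.\<close>

lemma horadam3_Suc_eq_scaled:
  fixes l :: "'a::comm_ring_1" and T :: "nat \<Rightarrow> 'a"
  assumes "T 0 = 0" and "T 1 = 0" and "T 2 = 1"
    and rec: "\<And>n. T (n + 3) = T (n + 2) + 3 * T (n + 1) + 9 * T n"
  shows "horadam3 1 0 0 l (3 * l ^ 2) (9 * l ^ 3) (Suc n) = 9 * l ^ Suc n * T n"
proof (induction n rule: less_induct)
  case (less n)
  consider "n = 0" | "n = 1" | "n = 2" | m where "n = m + 3"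
    by (metis One_nat_def add.commute le_Suc_ex less_2_cases not_less numeral_2_eq_2 numeral_3_eq_3 less_Suc_eq)
  then show ?case
  proof cases
    case 4
    have "horadam3 1 0 0 l (3 * l ^ 2) (9 * l ^ 3) (Suc n) =
        l * (9 * l ^ (m + 3) * T (m + 2)) + 3 * l ^ 2 * (9 * l ^ (m + 2) * T (m + 1))
        + 9 * l ^ 3 * (9 * l ^ (m + 1) * T m)"
      using less[of "m + 2"] less[of "m + 1"] less[of m] unfolding 4
      by (simp add: numeral_3_eq_3 numeral_2_eq_2)
    \<comment> \<open>Each of the three terms carries the same power \<open>l ^ (m + 4)\<close>;
      factoring it out leaves the recurrence of \<open>T\<close>.\<close>
    also have "\<dots> = 9 * l ^ Suc n * T n"
      unfolding 4 rec by (simp add: algebra_simps power_add numeral_eq_Suc)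
    finally show ?thesis .
  \<comment> \<open>The factor 9 arises at \<open>n = 2\<close>: one unfolding gives
    \<open>9 * l ^ 3\<close> times the initial value 1.\<close>
  qed (use assms in \<open>simp_all add: numeral_2_eq_2 numeral_3_eq_3\<close>)
qed

theorem proposition3p2:
  fixes l :: real and T :: "nat \<Rightarrow> real"
  assumes "l \<noteq> 0"
    and "T 0 = 0" and "T 1 = 0" and "T 2 = 1"
    and "\<And>n. T (n + 3) = T (n + 2) + 3 * T (n + 1) + 9 * T n"
  shows "\<forall>n\<ge>2. T (n - 1) = 1 / (9 * l ^ n) * horadam3 1 0 0 l (3 * l ^ 2) (9 * l ^ 3) n"
proof (intro allI impI)
  fix n :: nat
  assume "n \<ge> 2"
  then obtain m where n: "n = Suc m" by (cases n) auto
  show "T (n - 1) = 1 / (9 * l ^ n) * horadam3 1 0 0 l (3 * l ^ 2) (9 * l ^ 3) n"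
    using horadam3_Suc_eq_scaled[OF assms(2-5), of l m] assms(1) unfolding n by simp
qed

end
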